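(* Let $d\ge2$, let $\psi:[0,\infty)\to(0,1]$ be a strict $d$-monotone Archimedean generator that is continuously differentiable on $(0,\infty)$, with $K_\psi:=\sup_{t>0}t|\psi'(t)|<\infty$. Let $F_k=e^{-V_k}$, $k=1,2$, be $d$-dimensional max-stable distribution functions with unit-Fréchet margins, let $\ell_k(z)=V_k(1/z)$ be their stable tail dependence functions, and let $C_k$ be the Archimax copulas $$C_k(u)=\psi\Bigl(\ell_k\bigl(\psi^{-1}(u_1),\dots,\psi^{-1}(u_d)\bigr)\Bigr),\qquad u\in(0,1]^d,\quad k=1,2.$$ Let $S$ be either the positive unit sphere of a norm on $\mathbb{R}^d$ or the sphere $S_\tau=\{s\in[0,\infty)^d:\tau(s)=1\}$ of an admissible gauge $\tau$, let $H_k$ be the angular measure of $F_k$ on $S$, and set $$M_\infty:=\sup_{s\in S}\|s\|_\infty,\qquad\mathcal W_1:=\inf_{Z^{(1)},Z^{(2)}}W_{1,\|\cdot\|_\infty}(Z^{(1)},Z^{(2)}),$$ the infimum being over all de Haan representers $Z^{(1)}$ of $F_1$ and $Z^{(2)}$ of $F_2$. Then $$\mathrm d_K(C_1,C_2)\le K_\psi\Bigl(\mathcal W_1\wedge M_\infty\|H_1-H_2\|_{\mathrm{TV}}\Bigr).$$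
   Context: $a\wedge b=\min(a,b)$; $\|x\|_\infty=\max_j|x_j|$. For copulas, $\mathrm d_K(C_1,C_2)=\sup_{u\in[0,1]^d}|C_1(u)-C_2(u)|$ (the $C_k$ are extended to $[0,1]^d$ by continuity). Strict $d$-monotone Archimedean generator: $\psi$ is strictly decreasing with $\psi(0)=1$, $\lim_{t\to\infty}\psi(t)=0$, it is differentiable up to order $d-2$ on $(0,\infty)$ with $(-1)^m\psi^{(m)}(t)\ge0$ for $m=0,\dots,d-2$, and $(-1)^{d-2}\psi^{(d-2)}$ is nonincreasing and convex. De Haan representers: a $d$-dimensional max-stable distribution function $F$ with unit-Fréchet margins (each margin is $x\mapsto e^{-1/x}$, $x>0$) has the form $F(x)=e^{-V(x)}$ for $x\in(0,\infty)^d$, where $V(x)=\mathbb{E}\{\max_{1\le j\le d}Z_j/x_j\}$ for some random vector $Z$ with values in $[0,\infty)^d$ with $\mathbb{E}\{Z_j\}=1$ for all $j$ and $\mathbb{P}\{\max_jZ_j>0\}=1$; any such $Z$ is a de Haan representer of $F$. The stable tail dependence function is $\ell(z)=V(1/z)=\mathbb{E}\{\max_jz_jZ_j\}$, $z\in[0,\infty)^d$ (with $1/z$ componentwise and $1/0=+\infty$). Admissible gauge: a Borel-measurable $1$-homogeneous map $\tau:[0,\infty)^d\to[0,\infty)$ for which there are constants $0<a\le b<\infty$ with $a\|x\|_\infty\le\tau(x)\le b\|x\|_\infty$ for all $x\in[0,\infty)^d$. Angular measure: with $\tau$ the norm or gauge defining $S$, $H(B)=\mathbb{E}\{\tau(Z)\,\mathbb{I}(Z/\tau(Z)\in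 B)\}$, $B\in\mathcal B(S)$, for a de Haan representer $Z$ of $F$; it satisfies $\int_Ss_jH(ds)=1$ for all $j$ and $V(x)=\int_S\max_j(s_j/x_j)H(ds)$. Total variation: $\|H_1-H_2\|_{\mathrm{TV}}=\sup_{A\in\mathcal B(S)}|H_1(A)-H_2(A)|$. Wasserstein distance: $W_{1,\|\cdot\|_\infty}(U,V)=\inf_\pi\int\|x-y\|_\infty\,\pi(dx,dy)$ over all couplings $\pi$ of the laws of $U$ and $V$. *)

theory Defs
  imports "HOL-Probability.Probability"
begin

section \<open>Archimedean generators\<close>

text \<open>Only the values of the generator on the half-line \<open>[0, \<infinity>)\<close> matter.\<close>

definition strict_generator :: "nat \<Rightarrow> (real \<Rightarrow> real) \<Rightarrow> bool" where
  "strict_generator d \<psi> \<longleftrightarrow>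
     strict_antimono_on {0..} \<psi> \<and> \<psi> 0 = 1 \<and> (\<psi> \<longlongrightarrow> 0) at_top \<and>
     (\<forall>m < d - 2. \<forall>t > 0. (deriv ^^ m) \<psi> differentiable (at t)) \<and>
     (\<forall>m \<le> d - 2. \<forall>t > 0. (-1) ^ m * (deriv ^^ m) \<psi> t \<ge> 0) \<and>
     antimono_on {0<..} (\<lambda>t. (-1) ^ (d - 2) * (deriv ^^ (d - 2)) \<psi> t) \<and>
     convex_on {0<..} (\<lambda>t. (-1) ^ (d - 2) * (deriv ^^ (d - 2)) \<psi> t)"

definition K_gen :: "(real \<Rightarrow> real) \<Rightarrow> real" where
  "K_gen \<psi> = (SUP t\<in>{0<..}. t * \<bar>deriv \<psi> t\<bar>)"

text \<open>
  The usual inverse of a generator.  On the range of the generator it is the ordinary inverse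
  (lemma below); since continuity at 0 is not part of the definition of a
  generator, the infimum also covers levels in a possible jump at 0.
\<close>

definition gen_inv :: "(real \<Rightarrow> real) \<Rightarrow> real \<Rightarrow> real" where
  "gen_inv \<psi> u = Inf {t. 0 \<le> t \<and> \<psi> t \<le> u}"

lemma gen_inv_eq:
  assumes "strict_antimono_on {0..} \<psi>" "t \<ge> 0"
  shows "gen_inv \<psi> (\<psi> t) = t"
proof -
  have "{s. 0 \<le> s \<and> \<psi> s \<le> \<psi> t} = {t..}"
  proof (intro set_eqI iffI)
    fix s assume s: "s \<in> {s. 0 \<le> s \<and> \<psi> s \<le> \<psi> t}"
    show "s \<in> {t..}"
    proof (rule ccontr)
      assume "s \<notin> {t..}"
      then have "\<psi> s > \<psi> t"
        using assms s monotone_onD[of "{0..}" "(<)" "(>)" \<psi> s t] by auto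
      with s show False by auto
    qed
  next
    fix s assume "s \<in> {t..}"
    then have "s = t \<or> \<psi> s < \<psi> t"
      using assms monotone_onD[of "{0..}" "(<)" "(>)" \<psi> t s] by (cases "s = t") auto
    with \<open>s \<in> {t..}\<close> assms(2) show "s \<in> {s. 0 \<le> s \<and> \<psi> s \<le> \<psi> t}" by auto
  qed
  then show ?thesis by (simp add: gen_inv_def)
qed

lemma gen_inv_the_inv_into:
  assumes "strict_antimono_on {0..} \<psi>" "u \<in> \<psi> ` {0..}"
  shows "gen_inv \<psi> u = the_inv_into {0..} \<psi> u"
proof -
  have inj: "inj_on \<psi> {0..}"
    by (rule inj_on_inverseI[where g = "gen_inv \<psi>"]) (use assms(1) gen_inv_eq in auto)
  from assms(2) obtain t where "t \<ge> 0" "u = \<psi> t" by auto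
  then show ?thesis
    using gen_inv_eq[OF assms(1)] the_inv_into_f_f[OF inj] by auto
qed

section \<open>Max-stable distribution functions\<close>

text \<open>
  Multivariate distribution functions take arguments in \<open>[-\<infinity>, \<infinity>]\<^sup>d\<close>, so that margins and
  \<open>V (1 / z)\<close> with \<open>1 / 0 = \<infinity>\<close> are evaluations of the same function.
\<close>

definition distribution_fn :: "(ereal ^ 'd::finite \<Rightarrow> real) \<Rightarrow> bool" where
  "distribution_fn F \<longleftrightarrow>
     (\<exists>P :: (real ^ 'd) measure. prob_space P \<and> sets P = sets borel \<and>
        (\<forall>x. F x = measure P {y. \<forall>j. ereal (y $ j) \<le> x $ j}))"

definition max_stable :: "(ereal ^ 'd::finite \<Rightarrow> real) \<Rightarrow> bool" where
  "max_stable F \<longleftrightarrow> distribution_fn F \<and>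
     (\<forall>n \<ge> 1. \<exists>a b :: real ^ 'd. (\<forall>j. a $ j > 0) \<and>
        (\<forall>x :: real ^ 'd. F (\<chi> j. ereal (a $ j * x $ j + b $ j)) ^ n = F (\<chi> j. ereal (x $ j))))"

definition unit_frechet_margins :: "(ereal ^ 'd::finite \<Rightarrow> real) \<Rightarrow> bool" where
  "unit_frechet_margins F \<longleftrightarrow>
     (\<forall>i. \<forall>x :: real. x > 0 \<longrightarrow> F (\<chi> j. if j = i then ereal x else \<infinity>) = exp (- 1 / x))"

definition exponent_fn :: "(ereal ^ 'd::finite \<Rightarrow> real) \<Rightarrow> ereal ^ 'd \<Rightarrow> real" where
  "exponent_fn F x = - ln (F x)"

definition stdf :: "(ereal ^ 'd::finite \<Rightarrow> real) \<Rightarrow> real ^ 'd \<Rightarrow> real" where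
  "stdf F z = exponent_fn F (\<chi> j. 1 / ereal (z $ j))"

definition orthant :: "(real ^ 'd::finite) set" where
  "orthant = {x. \<forall>j. 0 \<le> x $ j}"

definition de_haan_representer ::
    "(ereal ^ 'd::finite \<Rightarrow> real) \<Rightarrow> 'a measure \<Rightarrow> ('a \<Rightarrow> real ^ 'd) \<Rightarrow> bool" where
  "de_haan_representer F M Z \<longleftrightarrow>
     prob_space M \<and> Z \<in> borel_measurable M \<and> (\<forall>\<omega>\<in>space M. Z \<omega> \<in> orthant) \<and>
     (\<forall>j. integrable M (\<lambda>\<omega>. Z \<omega> $ j) \<and> (\<integral>\<omega>. Z \<omega> $ j \<partial>M) = 1) \<and>
     measure M {\<omega> \<in> space M. (MAX j. Z \<omega> $ j) > 0} = 1 \<and>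
     (\<forall>x :: real ^ 'd. (\<forall>j. x $ j > 0) \<longrightarrow>
        F (\<chi> j. ereal (x $ j)) = exp (- (\<integral>\<omega>. (MAX j. Z \<omega> $ j / x $ j) \<partial>M)))"

text \<open>
  The laws of the representers of \<open>F\<close>.  Probability spaces on the type \<open>real ^ 'd\<close> suffice, since
  representers on other probability spaces yield no further laws (lemma below).
\<close>

definition representer_law :: "(ereal ^ 'd::finite \<Rightarrow> real) \<Rightarrow> (real ^ 'd) measure \<Rightarrow> bool" where
  "representer_law F \<mu> \<longleftrightarrow>
     (\<exists>(M :: (real ^ 'd) measure) Z. de_haan_representer F M Z \<and> \<mu> = distr M borel Z)"

lemma representer_law_distr:
  fixes F :: "ereal ^ 'd::finite \<Rightarrow> real"
  assumes "de_haan_representer F M Z"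
  shows "representer_law F (distr M borel Z)"
proof -
  define p :: "real ^ 'd \<Rightarrow> real ^ 'd" where "p x = (\<chi> j. max 0 (x $ j))" for x
  have [measurable]: "Z \<in> borel_measurable M" and ps: "prob_space M"
    and pos: "\<And>\<omega>. \<omega> \<in> space M \<Longrightarrow> Z \<omega> \<in> orthant"
    using assms by (auto simp: de_haan_representer_def)
  have "continuous_on UNIV p"
    unfolding p_def by (intro continuous_intros)
  then have p [measurable]: "p \<in> borel_measurable borel"
    by (rule borel_measurable_continuous_onI)
  have pZ: "p (Z \<omega>) = Z \<omega>" if "\<omega> \<in> space M" for \<omega>
    using pos[OF that] by (auto simp: p_def orthant_def vec_eq_iff max_def)
  let ?N = "distr M borel Z"
  have nth [measurable]: "(\<lambda>x. x $ j) \<in> borel_measurable (borel :: (real ^ 'd) measure)" for j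
    by (intro borel_measurable_continuous_onI continuous_intros)
  have max_meas [measurable]:
    "(\<lambda>x. MAX j. p x $ j / c j) \<in> borel_measurable borel" for c :: "'d \<Rightarrow> real"
    by (intro borel_measurable_Max) measurable
  have max_meas1 [measurable]: "(\<lambda>x. MAX j. p x $ j) \<in> borel_measurable borel"
    using max_meas[of "\<lambda>_. 1"] by simp
  have "prob_space ?N" by (intro prob_space.prob_space_distr ps) measurable
  moreover have "p x \<in> orthant" for x by (simp add: p_def orthant_def)
  moreover have "integrable ?N (\<lambda>x. p x $ j) \<and> (\<integral>x. p x $ j \<partial>?N) = 1" for j
  proof -
    have "integrable M (\<lambda>\<omega>. p (Z \<omega>) $ j) \<longleftrightarrow> integrable M (\<lambda>\<omega>. Z \<omega> $ j)"
      by (rule Bochner_Integration.integrable_cong) (auto simp: pZ)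
    moreover have "(\<integral>\<omega>. p (Z \<omega>) $ j \<partial>M) = (\<integral>\<omega>. Z \<omega> $ j \<partial>M)"
      by (rule Bochner_Integration.integral_cong) (auto simp: pZ)
    ultimately show ?thesis
      using assms by (simp add: de_haan_representer_def integrable_distr_eq integral_distr)
  qed
  moreover have "measure ?N {x \<in> space ?N. (MAX j. p x $ j) > 0} = 1"
  proof -
    have "measure ?N {x \<in> space ?N. (MAX j. p x $ j) > 0} =
        measure M (Z -` {x \<in> space ?N. (MAX j. p x $ j) > 0} \<inter> space M)"
      by (rule measure_distr) measurable
    also have "Z -` {x \<in> space ?N. (MAX j. p x $ j) > 0} \<inter> space M =
        {\<omega> \<in> space M. (MAX j. Z \<omega> $ j) > 0}"
      using pZ by auto
    finally show ?thesis using assms by (simp add: de_haan_representer_def)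
  qed
  moreover have "(\<integral>x. (MAX j. p x $ j / c $ j) \<partial>?N) = (\<integral>\<omega>. (MAX j. Z \<omega> $ j / c $ j) \<partial>M)"
    for c :: "real ^ 'd"
  proof -
    have "(\<integral>x. (MAX j. p x $ j / c $ j) \<partial>?N) = (\<integral>\<omega>. (MAX j. p (Z \<omega>) $ j / c $ j) \<partial>M)"
      by (rule integral_distr) measurable
    also have "\<dots> = (\<integral>\<omega>. (MAX j. Z \<omega> $ j / c $ j) \<partial>M)"
      by (rule Bochner_Integration.integral_cong) (auto simp: pZ)
    finally show ?thesis .
  qed
  ultimately have "de_haan_representer F ?N p"
    using assms by (simp add: de_haan_representer_def)
  moreover have "distr ?N borel p = ?N"
  proof -
    have "distr ?N borel p = distr M borel (p \<circ> Z)"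
      by (rule distr_distr) measurable
    also have "\<dots> = ?N" by (rule distr_cong) (auto simp: pZ)
    finally show ?thesis .
  qed
  ultimately show ?thesis unfolding representer_law_def by metis
qed

section \<open>Gauges and angular measures\<close>

definition is_norm :: "(real ^ 'd::finite \<Rightarrow> real) \<Rightarrow> bool" where
  "is_norm N \<longleftrightarrow> (\<forall>x. 0 \<le> N x) \<and> (\<forall>x. N x = 0 \<longleftrightarrow> x = 0) \<and>
     (\<forall>x y. N (x + y) \<le> N x + N y) \<and> (\<forall>c x. N (c *\<^sub>R x) = \<bar>c\<bar> * N x)"

definition admissible_gauge :: "(real ^ 'd::finite \<Rightarrow> real) \<Rightarrow> bool" where
  "admissible_gauge \<tau> \<longleftrightarrow>
     \<tau> \<in> borel_measurable (restrict_space borel orthant) \<and>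
     (\<forall>x\<in>orthant. 0 \<le> \<tau> x) \<and>
     (\<forall>x\<in>orthant. \<forall>c > 0. \<tau> (c *\<^sub>R x) = c * \<tau> x) \<and>
     (\<exists>a b. 0 < a \<and> a \<le> b \<and> (\<forall>x\<in>orthant. a * infnorm x \<le> \<tau> x \<and> \<tau> x \<le> b * infnorm x))"

definition pos_sphere :: "(real ^ 'd::finite \<Rightarrow> real) \<Rightarrow> (real ^ 'd) set" where
  "pos_sphere \<tau> = {s \<in> orthant. \<tau> s = 1}"

definition angular_measure ::
    "(real ^ 'd::finite \<Rightarrow> real) \<Rightarrow> (ereal ^ 'd \<Rightarrow> real) \<Rightarrow> (real ^ 'd) measure \<Rightarrow> bool" where
  "angular_measure \<tau> F H \<longleftrightarrow>
     sets H = sets (restrict_space borel (pos_sphere \<tau>)) \<and>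
     (\<exists>(M :: (real ^ 'd) measure) Z. de_haan_representer F M Z \<and>
        (\<forall>B \<in> sets H.
           emeasure H B = (\<integral>\<^sup>+\<omega>. ennreal (\<tau> (Z \<omega>)) * indicator B (Z \<omega> /\<^sub>R \<tau> (Z \<omega>)) \<partial>M)))"

definition M_inf :: "(real ^ 'd::finite) set \<Rightarrow> real" where
  "M_inf S = (SUP s\<in>S. infnorm s)"

text \<open>For finite measures on the same measurable space.\<close>

definition tv_dist :: "'a measure \<Rightarrow> 'a measure \<Rightarrow> real" where
  "tv_dist H1 H2 = (SUP A\<in>sets H1. \<bar>measure H1 A - measure H2 A\<bar>)"

section \<open>Wasserstein distance\<close>

definition couplings ::
    "(real ^ 'd::finite) measure \<Rightarrow> (real ^ 'd) measure \<Rightarrow> ((real ^ 'd) \<times> (real ^ 'd)) measure set" where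
  "couplings \<mu> \<nu> =
     {\<pi>. sets \<pi> = sets (borel \<Otimes>\<^sub>M borel) \<and> distr \<pi> borel fst = \<mu> \<and> distr \<pi> borel snd = \<nu>}"

definition wasserstein1 :: "(real ^ 'd::finite) measure \<Rightarrow> (real ^ 'd) measure \<Rightarrow> ennreal" where
  "wasserstein1 \<mu> \<nu> = (INF \<pi>\<in>couplings \<mu> \<nu>. \<integral>\<^sup>+p. ennreal (infnorm (fst p - snd p)) \<partial>\<pi>)"

definition representer_W1 ::
    "(ereal ^ 'd::finite \<Rightarrow> real) \<Rightarrow> (ereal ^ 'd \<Rightarrow> real) \<Rightarrow> ennreal" where
  "representer_W1 F1 F2 =
     (INF (\<mu>, \<nu>)\<in>{\<mu>. representer_law F1 \<mu>} \<times> {\<nu>. representer_law F2 \<nu>}. wasserstein1 \<mu> \<nu>)"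

section \<open>Archimax copulas\<close>

definition archimax ::
    "(real \<Rightarrow> real) \<Rightarrow> (real ^ 'd::finite \<Rightarrow> real) \<Rightarrow> real ^ 'd \<Rightarrow> real" where
  "archimax \<psi> l u = \<psi> (l (\<chi> j. gen_inv \<psi> (u $ j)))"

definition half_open_cube :: "(real ^ 'd::finite) set" where
  "half_open_cube = {u. \<forall>j. 0 < u $ j \<and> u $ j \<le> 1}"

definition unit_cube :: "(real ^ 'd::finite) set" where
  "unit_cube = {u. \<forall>j. 0 \<le> u $ j \<and> u $ j \<le> 1}"

definition extend_by_continuity :: "(real ^ 'd::finite \<Rightarrow> real) \<Rightarrow> real ^ 'd \<Rightarrow> real" where
  "extend_by_continuity C u =
     (if u \<in> half_open_cube then C u else Lim (at u within half_open_cube) C)"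

definition d_K :: "(real ^ 'd::finite \<Rightarrow> real) \<Rightarrow> (real ^ 'd \<Rightarrow> real) \<Rightarrow> real" where
  "d_K C1 C2 = (SUP u\<in>unit_cube. \<bar>extend_by_continuity C1 u - extend_by_continuity C2 u\<bar>)"

end

theory Submission
  imports Defs
begin

text \<open>
  Write \<open>\<ell>\<^sub>k\<close> for the stable tail dependence functions \<open>stdf F\<^sub>k\<close>.  The argument combines a local
  Lipschitz estimate for \<open>\<psi>\<close> with two bounds on \<open>\<bar>\<ell>\<^sub>1 z - \<ell>\<^sub>2 z\<bar>\<close> that are linear in \<open>\<parallel>z\<parallel>\<^sub>\<infinity>\<close>.

  If \<open>x, y \<ge> m > 0\<close>, the mean value theorem gives \<open>\<bar>\<psi> x - \<psi> y\<bar> \<le> K \<bar>x - y\<bar> / m\<close> with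
  \<open>K = K_gen \<psi>\<close>, because \<open>t \<bar>\<psi>' t\<bar> \<le> K\<close> (lemma \<open>generator_diff_le\<close>).  Since
  \<open>\<ell>\<^sub>k z = E (max\<^sub>j z\<^sub>j Z\<^sub>j) \<ge> max\<^sub>j z\<^sub>j E Z\<^sub>j = \<parallel>z\<parallel>\<^sub>\<infinity>\<close>, one may take \<open>m = \<parallel>z\<parallel>\<^sub>\<infinity>\<close>, and it
  remains to bound \<open>\<bar>\<ell>\<^sub>1 z - \<ell>\<^sub>2 z\<bar> / \<parallel>z\<parallel>\<^sub>\<infinity>\<close> uniformly in \<open>z\<close>.

  For the Wasserstein term, \<open>x \<mapsto> max\<^sub>j z\<^sub>j x\<^sub>j\<close> is \<open>\<parallel>z\<parallel>\<^sub>\<infinity>\<close>-Lipschitz for the maximum norm, so every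
  coupling of every pair of representers yields a bound (lemma \<open>stdf_diff_le_W1\<close>).  For the total
  variation term, \<open>\<ell>\<^sub>k z\<close> is the integral of \<open>max\<^sub>j z\<^sub>j s\<^sub>j\<close> with respect to the angular measure
  \<open>H\<^sub>k\<close>; on the sphere the integrand has values in \<open>[0, \<parallel>z\<parallel>\<^sub>\<infinity> M\<^sub>\<infinity>]\<close>, and slicing it into level
  sets bounds the difference of the two integrals by \<open>\<parallel>z\<parallel>\<^sub>\<infinity> M\<^sub>\<infinity>\<close> times the total variation
  (lemma \<open>stdf_diff_le_tv_dist\<close>).

  At the points of the cube with a zero coordinate both copulas extend by \<open>0\<close>, so these points do
  not contribute to the supremum (lemma \<open>archimax_boundary\<close>).  The bounds are assembled in lemma
  \<open>d_K_archimax_le\<close>.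
\<close>

section \<open>The function \<open>max\<^sub>j z\<^sub>j x\<^sub>j\<close>\<close>

text \<open>
  The integrand of the stable tail dependence function: if \<open>Z\<close> represents \<open>F\<close>, then
  \<open>stdf F z = E (max_prod z Z)\<close> for \<open>z\<close> in the orthant.
\<close>

definition max_prod :: "real ^ 'd::finite \<Rightarrow> real ^ 'd \<Rightarrow> real" where
  "max_prod z x = (MAX j. z $ j * x $ j)"

lemma infnorm_le_iff: "infnorm (x :: real ^ 'd::finite) \<le> c \<longleftrightarrow> (\<forall>j. \<bar>x $ j\<bar> \<le> c)"
proof
  assume "\<forall>j. \<bar>x $ j\<bar> \<le> c"
  then show "infnorm x \<le> c"
    unfolding infnorm_cart by (intro cSup_least) auto
next
  assume "infnorm x \<le> c"
  then show "\<forall>j. \<bar>x $ j\<bar> \<le> c"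
    using component_le_infnorm_cart order_trans by blast
qed

lemma max_prod_le_iff: "max_prod z x \<le> c \<longleftrightarrow> (\<forall>j. z $ j * x $ j \<le> c)"
  unfolding max_prod_def by (subst Max_le_iff) auto

lemma max_prod_ge: "z $ j * x $ j \<le> max_prod z x"
  using max_prod_le_iff[of z x "max_prod z x"] by simp

lemma max_prod_commute: "max_prod z x = max_prod x z"
  by (simp add: max_prod_def mult.commute)

lemma max_prod_nonneg:
  assumes "z \<in> orthant" "x \<in> orthant"
  shows "0 \<le> max_prod z x"
  using assms max_prod_ge[of z undefined x] by (auto simp: orthant_def intro: order_trans[rotated])

lemma max_prod_zero [simp]: "max_prod z 0 = 0" "max_prod 0 x = 0"
  by (simp_all add: max_prod_def)

lemma max_prod_scaleR:
  assumes "0 < c"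
  shows "max_prod z (c *\<^sub>R x) = c * max_prod z x"
proof (rule antisym)
  show "max_prod z (c *\<^sub>R x) \<le> c * max_prod z x"
    using assms max_prod_ge[of z _ x] by (auto simp: max_prod_le_iff mult.left_commute)
  have "max_prod z x \<le> max_prod z (c *\<^sub>R x) / c"
    using assms max_prod_ge[of z _ "c *\<^sub>R x"]
    by (auto simp: max_prod_le_iff field_simps)
  then show "c * max_prod z x \<le> max_prod z (c *\<^sub>R x)"
    using assms by (simp add: field_simps)
qed

lemma max_prod_le:
  "max_prod z x \<le> max_prod z y + infnorm z * infnorm (x - y)"
  unfolding max_prod_le_iff
proof
  fix j
  have "z $ j * (x - y) $ j \<le> infnorm z * infnorm (x - y)"
    using abs_ge_self[of "z $ j * (x - y) $ j"]
      mult_mono[OF component_le_infnorm_cart[of z j] component_le_infnorm_cart[of "x - y" j]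
        infnorm_pos_le abs_ge_zero]
    by (simp add: abs_mult)
  with max_prod_ge[of z j y]
  show "z $ j * x $ j \<le> max_prod z y + infnorm z * infnorm (x - y)"
    by (simp add: algebra_simps)
qed

lemma max_prod_lipschitz:
  "\<bar>max_prod z x - max_prod z y\<bar> \<le> infnorm z * infnorm (x - y)"
  using max_prod_le[of z x y] max_prod_le[of z y x] infnorm_sub[of x y] by simp

lemma max_prod_le_infnorm: "max_prod z x \<le> infnorm z * infnorm x"
  using max_prod_le[of z x 0] by simp

lemma max_prod_measurable [measurable]: "max_prod z \<in> borel_measurable borel"
  unfolding max_prod_def
  by (intro borel_measurable_Max borel_measurable_continuous_onI continuous_intros) auto

lemma infnorm_measurable [measurable]:
  "infnorm \<in> borel_measurable (borel :: (real ^ 'd::finite) measure)"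
  by (intro borel_measurable_continuous_onI continuous_at_imp_continuous_on ballI
      continuous_infnorm continuous_ident)

section \<open>De Haan representers\<close>

lemma infnorm_le_sum:
  assumes "x \<in> orthant"
  shows "infnorm (x :: real ^ 'd::finite) \<le> (\<Sum>j\<in>UNIV. x $ j)"
  unfolding infnorm_le_iff
proof
  fix j
  have "x $ j \<le> (\<Sum>j\<in>UNIV. x $ j)"
    using assms by (intro member_le_sum) (auto simp: orthant_def)
  then show "\<bar>x $ j\<bar> \<le> (\<Sum>j\<in>UNIV. x $ j)" using assms by (auto simp: orthant_def)
qed

context
  fixes F :: "ereal ^ 'd::finite \<Rightarrow> real" and M :: "'a measure" and Z
  assumes rep: "de_haan_representer F M Z"
begin

lemma representer_measurable: "Z \<in> borel_measurable M"
  using rep by (simp add: de_haan_representer_def)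

lemma max_prod_representer_measurable: "(\<lambda>\<omega>. max_prod z (Z \<omega>)) \<in> borel_measurable M"
  by (rule measurable_compose[OF representer_measurable max_prod_measurable])

lemma representer_orthant: "\<omega> \<in> space M \<Longrightarrow> Z \<omega> \<in> orthant"
  using rep by (simp add: de_haan_representer_def)

lemma representer_component:
  "integrable M (\<lambda>\<omega>. Z \<omega> $ j)" "(\<integral>\<omega>. Z \<omega> $ j \<partial>M) = 1"
  using rep by (simp_all add: de_haan_representer_def)

lemma integrable_infnorm_representer: "integrable M (\<lambda>\<omega>. infnorm (Z \<omega>))"
proof (rule Bochner_Integration.integrable_bound)
  show "integrable M (\<lambda>\<omega>. \<Sum>j\<in>UNIV. Z \<omega> $ j)"
    by (intro Bochner_Integration.integrable_sum representer_component)
  show "AE \<omega> in M. norm (infnorm (Z \<omega>)) \<le> norm (\<Sum>j\<in>UNIV. Z \<omega> $ j)"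
  proof (intro AE_I2)
    fix \<omega> assume "\<omega> \<in> space M"
    then show "norm (infnorm (Z \<omega>)) \<le> norm (\<Sum>j\<in>UNIV. Z \<omega> $ j)"
      using infnorm_le_sum[OF representer_orthant] infnorm_pos_le[of "Z \<omega>"] by fastforce
  qed
qed (rule measurable_compose[OF representer_measurable infnorm_measurable])

lemma integrable_max_prod_representer:
  "integrable M (\<lambda>\<omega>. max_prod z (Z \<omega>))"
proof (rule Bochner_Integration.integrable_bound)
  show "integrable M (\<lambda>\<omega>. infnorm z * infnorm (Z \<omega>))"
    by (intro integrable_mult_right integrable_infnorm_representer)
  show "AE \<omega> in M. norm (max_prod z (Z \<omega>)) \<le> norm (infnorm z * infnorm (Z \<omega>))"
    using max_prod_lipschitz[of z "Z _" 0] by (auto simp: infnorm_pos_le)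
qed (rule max_prod_representer_measurable)

lemma infnorm_le_integral_max_prod:
  assumes "z \<in> orthant"
  shows "infnorm z \<le> (\<integral>\<omega>. max_prod z (Z \<omega>) \<partial>M)"
  unfolding infnorm_le_iff
proof
  fix j
  have "(\<integral>\<omega>. z $ j * Z \<omega> $ j \<partial>M) \<le> (\<integral>\<omega>. max_prod z (Z \<omega>) \<partial>M)"
    by (intro integral_mono integrable_mult_right representer_component
        integrable_max_prod_representer max_prod_ge)
  then show "\<bar>z $ j\<bar> \<le> (\<integral>\<omega>. max_prod z (Z \<omega>) \<partial>M)"
    using assms by (simp add: representer_component orthant_def)
qed

text \<open>
  A representer prescribes \<open>F\<close> only at finite positive arguments, whereas \<open>1 / z\<close> has infinite
  coordinates where \<open>z\<close> vanishes.  Those values follow by continuity from below of the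
  probability measure behind \<open>F\<close>.
\<close>

lemma stdf_representer:
  assumes F: "distribution_fn F" and z: "z \<in> orthant"
  shows "stdf F z = (\<integral>\<omega>. max_prod z (Z \<omega>) \<partial>M)"
proof -
  obtain P :: "(real ^ 'd) measure" where P: "prob_space P" "sets P = sets borel"
    "\<And>x. F x = measure P {y. \<forall>j. ereal (y $ j) \<le> x $ j}"
    using F by (auto simp: distribution_fn_def)
  interpret P: prob_space P by (rule P)
  \<comment> \<open>Only the zero coordinates are perturbed: decreasing the finite coordinates of \<open>1 / z\<close> as well
      would exhaust the box with strict inequalities only.\<close>
  define zn :: "nat \<Rightarrow> real ^ 'd"
    where "zn n = (\<chi> j. if z $ j = 0 then 1 / real (Suc n) else z $ j)" for n
  define x :: "ereal ^ 'd" where "x = (\<chi> j. 1 / ereal (z $ j))"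
  define A where "A n = {y :: real ^ 'd. \<forall>j. y $ j \<le> 1 / zn n $ j}" for n
  have zn_pos: "zn n $ j > 0" for n j
    using z by (auto simp: zn_def orthant_def less_le)
  have F_zn: "measure P (A n) = exp (- (\<integral>\<omega>. max_prod (zn n) (Z \<omega>) \<partial>M))" for n
  proof -
    have "F (\<chi> j. ereal ((\<chi> j. 1 / zn n $ j) $ j)) =
        exp (- (\<integral>\<omega>. (MAX j. Z \<omega> $ j / (\<chi> j. 1 / zn n $ j) $ j) \<partial>M))"
      using rep zn_pos unfolding de_haan_representer_def
      by (elim conjE allE[of _ "\<chi> j. 1 / zn n $ j"] impE) auto
    then show ?thesis by (simp add: P A_def max_prod_def mult.commute)
  qed
  have "(\<lambda>n. measure P (A n)) \<longlonglongrightarrow> measure P (\<Union>n. A n)"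
  proof (rule P.finite_Lim_measure_incseq)
    have "A n \<in> sets borel" for n
    proof -
      have "closed (A n)"
        unfolding A_def by (intro closed_Collect_all closed_Collect_le continuous_intros)
      then show ?thesis by simp
    qed
    then show "range A \<subseteq> sets P" using P by auto
    have "1 / zn m $ j \<le> 1 / zn n $ j" if "m \<le> n" for m n j
      using that by (simp add: zn_def)
    then show "incseq A"
      unfolding incseq_def A_def by (auto intro: order_trans)
  qed
  moreover have "(\<Union>n. A n) = {y. \<forall>j. ereal (y $ j) \<le> x $ j}"
  proof (intro set_eqI iffI)
    fix y assume "y \<in> (\<Union>n. A n)"
    then obtain n where "y \<in> A n" by auto
    then show "y \<in> {y. \<forall>j. ereal (y $ j) \<le> x $ j}"
      by (auto simp: A_def x_def zn_def divide_ereal_def inverse_eq_divide split: if_splits)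
  next
    fix y assume y: "y \<in> {y. \<forall>j. ereal (y $ j) \<le> x $ j}"
    obtain n where n: "infnorm y \<le> real n" using real_arch_simple by blast
    have "y $ j \<le> 1 / zn n $ j" for j
    proof (cases "z $ j = 0")
      case True
      have "y $ j \<le> real n" using n component_le_infnorm_cart[of y j] by linarith
      then show ?thesis using True by (simp add: zn_def)
    next
      case False
      then show ?thesis using y by (auto simp: zn_def x_def divide_ereal_def inverse_eq_divide dest!: spec[of _ j])
    qed
    then show "y \<in> (\<Union>n. A n)" by (auto simp: A_def)
  qed
  ultimately have lim1: "(\<lambda>n. exp (- (\<integral>\<omega>. max_prod (zn n) (Z \<omega>) \<partial>M))) \<longlonglongrightarrow> F x"
    by (simp add: F_zn P)
  have "(\<lambda>n. \<integral>\<omega>. max_prod (zn n) (Z \<omega>) \<partial>M) \<longlonglongrightarrow> (\<integral>\<omega>. max_prod z (Z \<omega>) \<partial>M)"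
  proof (rule LIM_zero_cancel, rule Lim_null_comparison)
    show "(\<lambda>n. 1 / real (Suc n) * (\<integral>\<omega>. infnorm (Z \<omega>) \<partial>M)) \<longlonglongrightarrow> 0"
      by (rule tendsto_mult_left_zero) (rule LIMSEQ_Suc[OF lim_1_over_n])
    show "\<forall>\<^sub>F n in sequentially. norm ((\<integral>\<omega>. max_prod (zn n) (Z \<omega>) \<partial>M) -
        (\<integral>\<omega>. max_prod z (Z \<omega>) \<partial>M)) \<le> 1 / real (Suc n) * (\<integral>\<omega>. infnorm (Z \<omega>) \<partial>M)"
    proof (intro always_eventually allI)
      fix n
      have *: "\<bar>max_prod (zn n) (Z \<omega>) - max_prod z (Z \<omega>)\<bar> \<le> 1 / real (Suc n) * infnorm (Z \<omega>)" for \<omega>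
      proof -
        have "infnorm (zn n - z) \<le> 1 / real (Suc n)"
          by (auto simp: infnorm_le_iff zn_def)
        then have "infnorm (Z \<omega>) * infnorm (zn n - z) \<le> infnorm (Z \<omega>) * (1 / real (Suc n))"
          by (intro mult_left_mono infnorm_pos_le)
        with max_prod_lipschitz[of "Z \<omega>" "zn n" z] show ?thesis
          by (simp add: max_prod_commute mult.commute)
      qed
      have "norm ((\<integral>\<omega>. max_prod (zn n) (Z \<omega>) \<partial>M) - (\<integral>\<omega>. max_prod z (Z \<omega>) \<partial>M))
          = norm (\<integral>\<omega>. max_prod (zn n) (Z \<omega>) - max_prod z (Z \<omega>) \<partial>M)"
        by (simp add: integrable_max_prod_representer)
      also have "\<dots> \<le> (\<integral>\<omega>. 1 / real (Suc n) * infnorm (Z \<omega>) \<partial>M)"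
        using * by (intro order_trans[OF integral_norm_bound] integral_mono integrable_norm
            Bochner_Integration.integrable_diff integrable_max_prod_representer
            integrable_mult_right integrable_infnorm_representer) simp
      finally show "norm ((\<integral>\<omega>. max_prod (zn n) (Z \<omega>) \<partial>M) -
        (\<integral>\<omega>. max_prod z (Z \<omega>) \<partial>M)) \<le> 1 / real (Suc n) * (\<integral>\<omega>. infnorm (Z \<omega>) \<partial>M)"
        by simp
    qed
  qed
  then have "(\<lambda>n. exp (- (\<integral>\<omega>. max_prod (zn n) (Z \<omega>) \<partial>M)))
      \<longlonglongrightarrow> exp (- (\<integral>\<omega>. max_prod z (Z \<omega>) \<partial>M))"
    by (intro tendsto_intros)
  with lim1 have "F x = exp (- (\<integral>\<omega>. max_prod z (Z \<omega>) \<partial>M))"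
    by (rule LIMSEQ_unique)
  then show ?thesis by (simp add: stdf_def exponent_fn_def x_def)
qed

end

section \<open>Wasserstein bound\<close>

lemma stdf_diff_le_W1:
  fixes F1 F2 :: "ereal ^ 'd::finite \<Rightarrow> real"
  assumes F: "distribution_fn F1" "distribution_fn F2" and z: "z \<in> orthant" "z \<noteq> 0"
  shows "ennreal (\<bar>stdf F1 z - stdf F2 z\<bar> / infnorm z) \<le> representer_W1 F1 F2"
  unfolding representer_W1_def wasserstein1_def
proof (intro INF_greatest, clarify, intro INF_greatest)
  fix \<mu> \<nu> \<pi>
  assume "representer_law F1 \<mu>" "representer_law F2 \<nu>"
  then obtain M1 M2 :: "(real ^ 'd) measure" and Z1 Z2
    where rep: "de_haan_representer F1 M1 Z1" "\<mu> = distr M1 borel Z1"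
      "de_haan_representer F2 M2 Z2" "\<nu> = distr M2 borel Z2"
    unfolding representer_law_def by blast
  assume "\<pi> \<in> couplings \<mu> \<nu>"
  then have sets_pi [measurable_cong]: "sets \<pi> = sets (borel \<Otimes>\<^sub>M borel)"
    and pi: "distr \<pi> borel fst = distr M1 borel Z1" "distr \<pi> borel snd = distr M2 borel Z2"
    using rep by (auto simp: couplings_def)
  note [measurable] = representer_measurable[OF rep(1)] representer_measurable[OF rep(3)]
  have l1: "integrable \<pi> (\<lambda>p. max_prod z (fst p))" "stdf F1 z = (\<integral>p. max_prod z (fst p) \<partial>\<pi>)"
  proof -
    have "integrable (distr M1 borel Z1) (max_prod z)"
      using integrable_max_prod_representer[OF rep(1)] by (subst integrable_distr_eq) auto
    then show "integrable \<pi> (\<lambda>p. max_prod z (fst p))"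
      unfolding pi(1)[symmetric] by (subst (asm) integrable_distr_eq) auto
    have "stdf F1 z = (\<integral>x. max_prod z x \<partial>distr M1 borel Z1)"
      using stdf_representer[OF rep(1) F(1) z(1)] by (subst integral_distr) auto
    also have "\<dots> = (\<integral>p. max_prod z (fst p) \<partial>\<pi>)"
      unfolding pi(1)[symmetric] by (subst integral_distr) auto
    finally show "stdf F1 z = (\<integral>p. max_prod z (fst p) \<partial>\<pi>)" .
  qed
  have l2: "integrable \<pi> (\<lambda>p. max_prod z (snd p))" "stdf F2 z = (\<integral>p. max_prod z (snd p) \<partial>\<pi>)"
  proof -
    have "integrable (distr M2 borel Z2) (max_prod z)"
      using integrable_max_prod_representer[OF rep(3)] by (subst integrable_distr_eq) auto
    then show "integrable \<pi> (\<lambda>p. max_prod z (snd p))"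
      unfolding pi(2)[symmetric] by (subst (asm) integrable_distr_eq) auto
    have "stdf F2 z = (\<integral>x. max_prod z x \<partial>distr M2 borel Z2)"
      using stdf_representer[OF rep(3) F(2) z(1)] by (subst integral_distr) auto
    also have "\<dots> = (\<integral>p. max_prod z (snd p) \<partial>\<pi>)"
      unfolding pi(2)[symmetric] by (subst integral_distr) auto
    finally show "stdf F2 z = (\<integral>p. max_prod z (snd p) \<partial>\<pi>)" .
  qed
  have z_pos: "infnorm z > 0" using z by (simp add: infnorm_pos_lt)
  have "ennreal (\<bar>stdf F1 z - stdf F2 z\<bar> / infnorm z) =
      ennreal (norm (\<integral>p. (max_prod z (fst p) - max_prod z (snd p)) / infnorm z \<partial>\<pi>))"
    using z_pos by (simp add: l1 l2 abs_divide)
  also have "\<dots> \<le> (\<integral>\<^sup>+p. ennreal (norm ((max_prod z (fst p) - max_prod z (snd p)) / infnorm z)) \<partial>\<pi>)"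
    using l1 l2 by (intro integral_norm_bound_ennreal) auto
  also have "\<dots> \<le> (\<integral>\<^sup>+p. ennreal (infnorm (fst p - snd p)) \<partial>\<pi>)"
    using max_prod_lipschitz z_pos
    by (intro nn_integral_mono ennreal_leI) (simp add: abs_divide divide_le_eq mult.commute)
  finally show "ennreal (\<bar>stdf F1 z - stdf F2 z\<bar> / infnorm z)
      \<le> (\<integral>\<^sup>+p. ennreal (infnorm (fst p - snd p)) \<partial>\<pi>)" .
qed

section \<open>Integrals and total variation\<close>

text \<open>
  A discrete layer cake argument: up to \<open>m / n\<close>, the function \<open>f\<close> is the average, multiplied by
  \<open>m\<close>, of the indicators of \<open>n\<close> superlevel sets.  The two measures may have different total mass.
\<close>

lemma integral_diff_le_of_measure_diff_le:
  fixes f :: "'a \<Rightarrow> real"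
  assumes H: "finite_measure H1" "finite_measure H2" "sets H2 = sets H1"
    and f [measurable]: "f \<in> borel_measurable H1"
    and m: "0 \<le> m" and f_bounds: "\<And>x. x \<in> space H1 \<Longrightarrow> 0 \<le> f x \<and> f x \<le> m"
    and t: "\<And>A. A \<in> sets H1 \<Longrightarrow> measure H1 A - measure H2 A \<le> t"
  shows "(\<integral>x. f x \<partial>H1) - (\<integral>x. f x \<partial>H2) \<le> m * t"
proof (cases "space H1 = {} \<or> m = 0")
  case True
  then have "f x = 0" if "x \<in> space H1" for x using f_bounds[OF that] that by auto
  then have "(\<integral>x. f x \<partial>H1) = (\<integral>x. 0 \<partial>H1)" "(\<integral>x. f x \<partial>H2) = (\<integral>x. 0 \<partial>H2)"
    using sets_eq_imp_space_eq[OF H(3)] by (intro Bochner_Integration.integral_cong; simp)+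
  with t[of "{}"] m show ?thesis by simp
next
  case False
  interpret H1: finite_measure H1 by (rule H)
  interpret H2: finite_measure H2 by (rule H)
  have space: "space H2 = space H1" using H(3) by (rule sets_eq_imp_space_eq)
  note [measurable_cong] = H(3)
  have m: "m > 0" using False m by simp
  define A where "A n k = {x \<in> space H1. m * real k / real n \<le> f x}" for n k :: nat
  have A [measurable]: "A n k \<in> sets H1" for n k
    unfolding A_def by measurable
  define g where "g n x = m / real n * (\<Sum>k=1..n. indicator (A n k) x)" for n x
  have g_bounds: "g n x \<le> f x" "f x \<le> g n x + m / real n" if x: "x \<in> space H1" and n: "n > 0" for n x
  proof -
    define y where "y = real n * f x / m"
    have y: "0 \<le> y" "y \<le> real n"
      using f_bounds[OF x] m n by (auto simp: y_def field_simps)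
    have "(\<Sum>k=1..n. indicator (A n k) x) = (\<Sum>k=1..n. if k \<le> nat \<lfloor>y\<rfloor> then 1 else 0 :: real)"
    proof (intro sum.cong refl)
      fix k
      have "k \<le> nat \<lfloor>y\<rfloor> \<longleftrightarrow> real k \<le> y" using y by (simp add: le_nat_iff le_floor_iff)
      also have "\<dots> \<longleftrightarrow> x \<in> A n k" using x m n by (simp add: A_def y_def field_simps)
      finally show "indicator (A n k) x = (if k \<le> nat \<lfloor>y\<rfloor> then 1 else 0 :: real)"
        by (simp add: indicator_def)
    qed
    also have "\<dots> = real (card ({1..n} \<inter> {k. k \<le> nat \<lfloor>y\<rfloor>}))"
      by (subst sum.If_cases) auto
    also have "{1..n} \<inter> {k. k \<le> nat \<lfloor>y\<rfloor>} = {1..nat \<lfloor>y\<rfloor>}"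
      using y by (auto simp: le_nat_iff le_floor_iff)
    finally have g: "g n x = m / real n * of_int \<lfloor>y\<rfloor>"
      using y by (simp add: g_def)
    have fx: "f x = m / real n * y" using m n by (simp add: y_def)
    show "g n x \<le> f x" unfolding g fx using m n by (intro mult_left_mono) (auto simp: less_imp_le)
    have "m / real n * y \<le> m / real n * (of_int \<lfloor>y\<rfloor> + 1)"
      using m by (intro mult_left_mono divide_nonneg_nonneg) linarith+
    then show "f x \<le> g n x + m / real n" unfolding g fx by (simp add: distrib_left)
  qed
  have bound: "(\<integral>x. f x \<partial>H1) - (\<integral>x. f x \<partial>H2) \<le> m * t + m * measure H1 (space H1) / real n"
    if n: "n > 0" for n
  proof -
    have int_g: "integrable H1 (g n)" "integrable H2 (g n)"
      unfolding g_def
      by (intro integrable_mult_right Bochner_Integration.integrable_sum integrable_real_indicator;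
        simp add: H1.emeasure_finite H2.emeasure_finite less_top[symmetric] H(3))+
    have int_f: "integrable H1 f" "integrable H2 f"
      using f_bounds space
      by (auto intro!: H1.integrable_const_bound[where B=m] H2.integrable_const_bound[where B=m])
    have g_int: "(\<integral>x. g n x \<partial>H1) = m / real n * (\<Sum>k=1..n. measure H1 (A n k))"
      "(\<integral>x. g n x \<partial>H2) = m / real n * (\<Sum>k=1..n. measure H2 (A n k))"
      unfolding g_def
      by (simp_all add: Bochner_Integration.integral_sum H(3) less_top[symmetric] integrable_real_indicator)
    have "(\<integral>x. f x \<partial>H1) \<le> (\<integral>x. g n x + m / real n \<partial>H1)"
      using g_bounds n int_f int_g by (intro integral_mono) auto
    moreover have "(\<integral>x. g n x \<partial>H2) \<le> (\<integral>x. f x \<partial>H2)"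
      using g_bounds n int_f int_g space by (intro integral_mono) auto
    ultimately have "(\<integral>x. f x \<partial>H1) - (\<integral>x. f x \<partial>H2)
        \<le> (\<integral>x. g n x \<partial>H1) - (\<integral>x. g n x \<partial>H2) + m / real n * measure H1 (space H1)"
      using int_g by (simp add: mult.commute)
    also have "(\<integral>x. g n x \<partial>H1) - (\<integral>x. g n x \<partial>H2)
        = m / real n * (\<Sum>k=1..n. measure H1 (A n k) - measure H2 (A n k))"
      by (simp add: g_int sum_subtractf right_diff_distrib)
    also have "\<dots> \<le> m / real n * (\<Sum>k=1..n. t)"
      using m t A by (intro mult_left_mono sum_mono) auto
    also have "\<dots> = m * t" using n by simp
    finally show ?thesis by simp
  qed
  have "(\<lambda>n. m * t + m * measure H1 (space H1) / real n) \<longlonglongrightarrow> m * t + 0"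
    by (intro tendsto_intros lim_const_over_n)
  then show ?thesis
    by (intro LIMSEQ_le_const[of _ _ "_ - _"]) (auto intro!: exI[of _ 1] bound)
qed

lemma integral_diff_le_tv_dist:
  fixes f :: "'a \<Rightarrow> real"
  assumes H: "finite_measure H1" "finite_measure H2" "sets H2 = sets H1"
    and f: "f \<in> borel_measurable H1"
    and m: "0 \<le> m" and f_bounds: "\<And>x. x \<in> space H1 \<Longrightarrow> 0 \<le> f x \<and> f x \<le> m"
  shows "\<bar>(\<integral>x. f x \<partial>H1) - (\<integral>x. f x \<partial>H2)\<bar> \<le> m * tv_dist H1 H2"
proof -
  interpret H1: finite_measure H1 by (rule H)
  interpret H2: finite_measure H2 by (rule H)
  have "bdd_above ((\<lambda>A. \<bar>measure H1 A - measure H2 A\<bar>) ` sets H1)"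
  proof (intro bdd_aboveI2)
    fix A
    show "\<bar>measure H1 A - measure H2 A\<bar> \<le> measure H1 (space H1) + measure H2 (space H2)"
      using H1.bounded_measure[of A] H2.bounded_measure[of A]
        measure_nonneg[of H1 A] measure_nonneg[of H2 A] by linarith
  qed
  then have tv: "\<bar>measure H1 A - measure H2 A\<bar> \<le> tv_dist H1 H2" if "A \<in> sets H1" for A
    using that unfolding tv_dist_def by (intro cSUP_upper)
  have "(\<integral>x. f x \<partial>H1) - (\<integral>x. f x \<partial>H2) \<le> m * tv_dist H1 H2"
    using tv by (intro integral_diff_le_of_measure_diff_le[OF H f m f_bounds]) fastforce+
  moreover have "(\<integral>x. f x \<partial>H2) - (\<integral>x. f x \<partial>H1) \<le> m * tv_dist H1 H2"
    using tv H f m f_bounds sets_eq_imp_space_eq[OF H(3)] measurable_cong_sets[OF H(3) refl]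
    by (intro integral_diff_le_of_measure_diff_le) fastforce+
  ultimately show ?thesis by linarith
qed

section \<open>Gauges and angular measures\<close>

text \<open>Equivalence of norms in finite dimension, by compactness of the Euclidean unit sphere.\<close>

lemma admissible_gauge_of_norm:
  fixes \<tau> :: "real ^ 'd::finite \<Rightarrow> real"
  assumes "is_norm \<tau>"
  shows "admissible_gauge \<tau>"
proof -
  have \<tau>: "0 \<le> \<tau> x" "\<tau> x = 0 \<longleftrightarrow> x = 0" "\<tau> (x + y) \<le> \<tau> x + \<tau> y" "\<tau> (c *\<^sub>R x) = \<bar>c\<bar> * \<tau> x" for x y c
    using assms by (auto simp: is_norm_def)
  define b where "b = (\<Sum>j\<in>UNIV. \<tau> (axis j 1))"
  have sum_le: "\<tau> (\<Sum>j\<in>I. h j) \<le> (\<Sum>j\<in>I. \<tau> (h j))" if "finite I" for h :: "'d \<Rightarrow> real ^ 'd" and I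
    using that
  proof (induction I rule: finite_induct)
    case empty
    then show ?case using \<tau>(2)[of 0] by simp
  next
    case (insert j I)
    then show ?case using \<tau>(3)[of "h j" "sum h I"] by simp
  qed
  have upper: "\<tau> x \<le> b * infnorm x" for x
  proof -
    have "\<tau> x = \<tau> (\<Sum>j\<in>UNIV. x $ j *\<^sub>R axis j 1)"
      using basis_expansion[of x] by (simp add: scalar_mult_eq_scaleR)
    also have "\<dots> \<le> (\<Sum>j\<in>UNIV. \<tau> (x $ j *\<^sub>R axis j 1))" by (intro sum_le) simp
    also have "\<dots> \<le> (\<Sum>j\<in>UNIV. infnorm x * \<tau> (axis j 1))"
      by (intro sum_mono) (simp add: \<tau> component_le_infnorm_cart mult_right_mono)
    finally show ?thesis by (simp add: b_def sum_distrib_left mult.commute)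
  qed
  have b: "b \<ge> 0" unfolding b_def by (intro sum_nonneg \<tau>)
  have lip: "\<bar>\<tau> x - \<tau> y\<bar> \<le> b * norm (x - y)" for x y
  proof -
    have "\<tau> x \<le> \<tau> y + \<tau> (x - y)" using \<tau>(3)[of y "x - y"] by simp
    moreover have "\<tau> y \<le> \<tau> x + \<tau> (y - x)" using \<tau>(3)[of x "y - x"] by simp
    moreover have "\<tau> (y - x) = \<tau> (x - y)" using \<tau>(4)[of "-1" "x - y"] by simp
    moreover have "\<tau> (x - y) \<le> b * norm (x - y)"
      using upper[of "x - y"] mult_left_mono[OF infnorm_le_norm b, of "x - y"] by linarith
    ultimately show ?thesis by linarith
  qed
  have "b-lipschitz_on UNIV \<tau>"
    using b lip by (intro lipschitz_onI) (auto simp: dist_norm)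
  then have cont: "continuous_on UNIV \<tau>" by (rule lipschitz_on_continuous_on)
  obtain a where a: "a > 0" "\<And>x. norm x = 1 \<Longrightarrow> a \<le> \<tau> x"
  proof -
    have "\<exists>x0\<in>sphere 0 1. \<forall>x\<in>sphere 0 1. \<tau> x0 \<le> \<tau> x"
      by (intro continuous_attains_inf continuous_on_subset[OF cont subset_UNIV]) auto
    then obtain x0 where x0: "x0 \<in> sphere 0 1" "\<And>x. x \<in> sphere 0 1 \<Longrightarrow> \<tau> x0 \<le> \<tau> x"
      by auto
    have "\<tau> x0 > 0" using x0(1) \<tau>(1)[of x0] \<tau>(2)[of x0] by (auto simp: less_le)
    with x0 that show ?thesis by auto
  qed
  have lower: "a * infnorm x \<le> \<tau> x" for x
  proof (cases "x = 0")
    case False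
    then have "a \<le> \<tau> (x /\<^sub>R norm x)" by (intro a) simp
    also have "\<dots> = \<tau> x / norm x" by (simp add: \<tau> field_simps)
    finally have "a * norm x \<le> \<tau> x" using False by (simp add: field_simps)
    with mult_left_mono[OF infnorm_le_norm[of x], of a] a(1) show ?thesis by linarith
  qed (simp add: \<tau> infnorm_0)
  have "a * infnorm (axis undefined 1 :: real ^ 'd) \<le> b * infnorm (axis undefined 1 :: real ^ 'd)"
    using upper lower order_trans by blast
  moreover have "infnorm (axis undefined 1 :: real ^ 'd) > 0"
    by (simp add: infnorm_pos_lt axis_eq_0_iff)
  ultimately have "a \<le> b" by simp
  then have "\<exists>a b. 0 < a \<and> a \<le> b \<and> (\<forall>x\<in>orthant. a * infnorm x \<le> \<tau> x \<and> \<tau> x \<le> b * infnorm x)"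
    using a(1) upper lower by blast
  moreover have "\<tau> \<in> borel_measurable (restrict_space borel orthant)"
    by (intro measurable_restrict_space1 borel_measurable_continuous_onI cont)
  ultimately show ?thesis
    using \<tau> by (simp add: admissible_gauge_def)
qed

context
  fixes \<tau> :: "real ^ 'd::finite \<Rightarrow> real"
  assumes gauge: "admissible_gauge \<tau>"
begin

lemma gauge_zero_iff:
  assumes "x \<in> orthant"
  shows "\<tau> x = 0 \<longleftrightarrow> x = 0"
proof -
  obtain a b where ab: "0 < a" "a * infnorm x \<le> \<tau> x" "\<tau> x \<le> b * infnorm x"
    using gauge assms by (auto simp: admissible_gauge_def)
  show ?thesis
  proof
    assume "\<tau> x = 0"
    then have "infnorm x \<le> 0" using ab by (simp add: mult_le_0_iff)
    then show "x = 0" using infnorm_pos_le[of x] infnorm_eq_0[of x] by simp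
  next
    assume "x = 0"
    then show "\<tau> x = 0" using ab by (simp add: infnorm_0)
  qed
qed

lemma gauge_pos:
  assumes "x \<in> orthant" "x \<noteq> 0"
  shows "\<tau> x > 0"
  using gauge gauge_zero_iff assms by (auto simp: admissible_gauge_def less_le)

lemma scale_to_pos_sphere:
  assumes "x \<in> orthant" "x \<noteq> 0"
  shows "x /\<^sub>R \<tau> x \<in> pos_sphere \<tau>"
  using gauge gauge_pos[OF assms] assms
  by (auto simp: admissible_gauge_def pos_sphere_def orthant_def)

lemma pos_sphere_nonempty: "pos_sphere \<tau> \<noteq> {}"
proof -
  have "axis undefined 1 \<in> (orthant :: (real ^ 'd) set)" "axis undefined 1 \<noteq> (0 :: real ^ 'd)"
    by (auto simp: orthant_def axis_def vec_eq_iff)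
  from scale_to_pos_sphere[OF this] show ?thesis by auto
qed

lemma infnorm_le_M_inf:
  assumes "s \<in> pos_sphere \<tau>"
  shows "infnorm s \<le> M_inf (pos_sphere \<tau>)"
proof -
  obtain a where "0 < a" "\<And>x. x \<in> orthant \<Longrightarrow> a * infnorm x \<le> \<tau> x"
    using gauge by (auto simp: admissible_gauge_def)
  then have "infnorm x \<le> 1 / a" if "x \<in> pos_sphere \<tau>" for x
    using that by (fastforce simp: pos_sphere_def field_simps)
  then have "bdd_above (infnorm ` pos_sphere \<tau>)" by (intro bdd_aboveI2)
  then show ?thesis unfolding M_inf_def using assms by (intro cSUP_upper)
qed

text \<open>
  The angular measure is the image of the measure with density \<open>\<tau> (Z \<omega>)\<close> under
  \<open>\<omega> \<mapsto> Z \<omega> / \<tau> (Z \<omega>)\<close>.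
\<close>

lemma nn_integral_angular_measure:
  assumes ang: "angular_measure \<tau> F H"
  obtains M :: "(real ^ 'd) measure" and Z where "de_haan_representer F M Z"
    and "\<And>f. f \<in> borel_measurable (restrict_space borel (pos_sphere \<tau>)) \<Longrightarrow>
      (\<integral>\<^sup>+s. f s \<partial>H) = (\<integral>\<^sup>+\<omega>. ennreal (\<tau> (Z \<omega>)) * f (Z \<omega> /\<^sub>R \<tau> (Z \<omega>)) \<partial>M)"
proof -
  obtain M :: "(real ^ 'd) measure" and Z where rep: "de_haan_representer F M Z"
    and sets_H: "sets H = sets (restrict_space borel (pos_sphere \<tau>))"
    and H: "\<And>B. B \<in> sets H \<Longrightarrow> emeasure H B =
       (\<integral>\<^sup>+\<omega>. ennreal (\<tau> (Z \<omega>)) * indicator B (Z \<omega> /\<^sub>R \<tau> (Z \<omega>)) \<partial>M)"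
    using ang by (auto simp: angular_measure_def)
  note [measurable] = representer_measurable[OF rep]
  have "Z \<in> M \<rightarrow>\<^sub>M restrict_space borel orthant"
    using representer_orthant[OF rep] by (intro measurable_restrict_space2) auto
  then have [measurable]: "(\<lambda>\<omega>. \<tau> (Z \<omega>)) \<in> borel_measurable M"
    using gauge by (auto simp: admissible_gauge_def intro: measurable_compose)
  obtain s0 where s0: "s0 \<in> pos_sphere \<tau>" using pos_sphere_nonempty by auto
  \<comment> \<open>Where \<open>Z\<close> vanishes the density vanishes too, so any value \<open>s0\<close> on the sphere will do.\<close>
  define T where "T \<omega> = (if \<tau> (Z \<omega>) = 0 then s0 else Z \<omega> /\<^sub>R \<tau> (Z \<omega>))" for \<omega>
  have T [measurable]: "T \<in> M \<rightarrow>\<^sub>M restrict_space borel (pos_sphere \<tau>)"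
  proof (intro measurable_restrict_space2)
    show "T \<in> space M \<rightarrow> pos_sphere \<tau>"
      using s0 scale_to_pos_sphere representer_orthant[OF rep] gauge_zero_iff
      by (fastforce simp: T_def)
    show "T \<in> borel_measurable M"
      unfolding T_def by measurable
  qed
  have weight: "ennreal (\<tau> (Z \<omega>)) * f (T \<omega>) = ennreal (\<tau> (Z \<omega>)) * f (Z \<omega> /\<^sub>R \<tau> (Z \<omega>))" for f \<omega>
    by (simp add: T_def)
  have H_eq: "H = distr (density M (\<lambda>\<omega>. ennreal (\<tau> (Z \<omega>)))) (restrict_space borel (pos_sphere \<tau>)) T"
  proof (rule measure_eqI)
    fix B assume B: "B \<in> sets H"
    have [measurable]: "B \<in> sets (restrict_space borel (pos_sphere \<tau>))" using B sets_H by simp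
    have "emeasure (distr (density M (\<lambda>\<omega>. ennreal (\<tau> (Z \<omega>)))) (restrict_space borel (pos_sphere \<tau>)) T) B
      = (\<integral>\<^sup>+\<omega>. ennreal (\<tau> (Z \<omega>)) * indicator (T -` B \<inter> space M) \<omega> \<partial>M)"
      by (simp add: emeasure_distr emeasure_density)
    also have "\<dots> = (\<integral>\<^sup>+\<omega>. ennreal (\<tau> (Z \<omega>)) * indicator B (T \<omega>) \<partial>M)"
      by (intro nn_integral_cong) (auto simp: indicator_def)
    finally show "emeasure H B = emeasure (distr (density M (\<lambda>\<omega>. ennreal (\<tau> (Z \<omega>))))
        (restrict_space borel (pos_sphere \<tau>)) T) B"
      using H[OF B] by (simp add: weight)
  qed (simp add: sets_H)
  show ?thesis
  proof (rule that[OF rep])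
    fix f :: "real ^ 'd \<Rightarrow> ennreal"
    assume [measurable]: "f \<in> borel_measurable (restrict_space borel (pos_sphere \<tau>))"
    show "(\<integral>\<^sup>+s. f s \<partial>H) = (\<integral>\<^sup>+\<omega>. ennreal (\<tau> (Z \<omega>)) * f (Z \<omega> /\<^sub>R \<tau> (Z \<omega>)) \<partial>M)"
      by (simp add: H_eq nn_integral_distr nn_integral_density weight)
  qed
qed

lemma finite_angular_measure:
  assumes ang: "angular_measure \<tau> F H"
  shows "finite_measure H"
proof -
  obtain M :: "(real ^ 'd) measure" and Z where rep: "de_haan_representer F M Z"
    and int: "\<And>f. f \<in> borel_measurable (restrict_space borel (pos_sphere \<tau>)) \<Longrightarrow>
      (\<integral>\<^sup>+s. f s \<partial>H) = (\<integral>\<^sup>+\<omega>. ennreal (\<tau> (Z \<omega>)) * f (Z \<omega> /\<^sub>R \<tau> (Z \<omega>)) \<partial>M)"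
    using nn_integral_angular_measure[OF ang] by blast
  obtain b where b: "\<And>x. x \<in> orthant \<Longrightarrow> \<tau> x \<le> b * infnorm x"
    using gauge unfolding admissible_gauge_def by blast
  have "emeasure H (space H) = (\<integral>\<^sup>+\<omega>. ennreal (\<tau> (Z \<omega>)) \<partial>M)"
    using int[of "\<lambda>_. 1"] by simp
  also have "\<dots> \<le> (\<integral>\<^sup>+\<omega>. ennreal (b * infnorm (Z \<omega>)) \<partial>M)"
    using b representer_orthant[OF rep] by (intro nn_integral_mono ennreal_leI) auto
  also have "\<dots> < \<infinity>"
    using integrableD(2)[OF integrable_mult_right[OF integrable_infnorm_representer[OF rep], of b]]
    by (simp add: less_top)
  finally show ?thesis by (intro finite_measureI) simp
qed

lemma stdf_angular_measure:
  assumes F: "distribution_fn F" and ang: "angular_measure \<tau> F H" and z: "z \<in> orthant"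
  shows "stdf F z = (\<integral>s. max_prod z s \<partial>H)"
proof -
  obtain M :: "(real ^ 'd) measure" and Z where rep: "de_haan_representer F M Z"
    and int: "\<And>f. f \<in> borel_measurable (restrict_space borel (pos_sphere \<tau>)) \<Longrightarrow>
      (\<integral>\<^sup>+s. f s \<partial>H) = (\<integral>\<^sup>+\<omega>. ennreal (\<tau> (Z \<omega>)) * f (Z \<omega> /\<^sub>R \<tau> (Z \<omega>)) \<partial>M)"
    using nn_integral_angular_measure[OF ang] by blast
  note [measurable] = representer_measurable[OF rep]
  have sets_H: "sets H = sets (restrict_space borel (pos_sphere \<tau>))"
    using ang by (simp add: angular_measure_def)
  have meas: "max_prod z \<in> borel_measurable (restrict_space borel (pos_sphere \<tau>))"
    by (intro measurable_restrict_space1) measurable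
  have "(\<integral>s. max_prod z s \<partial>H) = enn2real (\<integral>\<^sup>+s. ennreal (max_prod z s) \<partial>H)"
  proof (rule integral_eq_nn_integral)
    show "max_prod z \<in> borel_measurable H"
      using meas measurable_cong_sets[OF sets_H refl] by blast
    have "space H = pos_sphere \<tau>"
      using sets_eq_imp_space_eq[OF sets_H] by (simp add: space_restrict_space)
    then show "AE s in H. 0 \<le> max_prod z s"
      using max_prod_nonneg[OF z] by (intro AE_I2) (simp add: pos_sphere_def)
  qed
  also have "(\<integral>\<^sup>+s. ennreal (max_prod z s) \<partial>H) =
      (\<integral>\<^sup>+\<omega>. ennreal (\<tau> (Z \<omega>)) * ennreal (max_prod z (Z \<omega> /\<^sub>R \<tau> (Z \<omega>))) \<partial>M)"
    by (intro int measurable_compose[OF meas measurable_ennreal])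
  also have "\<dots> = (\<integral>\<^sup>+\<omega>. ennreal (max_prod z (Z \<omega>)) \<partial>M)"
  proof (intro nn_integral_cong)
    fix \<omega> assume "\<omega> \<in> space M"
    then have Z: "Z \<omega> \<in> orthant" by (rule representer_orthant[OF rep])
    show "ennreal (\<tau> (Z \<omega>)) * ennreal (max_prod z (Z \<omega> /\<^sub>R \<tau> (Z \<omega>))) = ennreal (max_prod z (Z \<omega>))"
    proof (cases "Z \<omega> = 0")
      case True
      then show ?thesis by simp
    next
      case False
      then show ?thesis
        using gauge_pos[OF Z False] max_prod_nonneg[OF z Z]
        by (simp add: max_prod_scaleR ennreal_mult'[symmetric])
    qed
  qed
  also have "enn2real \<dots> = (\<integral>\<omega>. max_prod z (Z \<omega>) \<partial>M)"
    using max_prod_nonneg[OF z representer_orthant[OF rep]]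
    by (intro integral_eq_nn_integral[symmetric] AE_I2 max_prod_representer_measurable[OF rep])
  finally show ?thesis by (simp add: stdf_representer[OF rep F z])
qed

lemma stdf_diff_le_tv_dist:
  assumes F: "distribution_fn F1" "distribution_fn F2"
    and ang: "angular_measure \<tau> F1 H1" "angular_measure \<tau> F2 H2"
    and z: "z \<in> orthant" "z \<noteq> 0"
  shows "\<bar>stdf F1 z - stdf F2 z\<bar> / infnorm z \<le> M_inf (pos_sphere \<tau>) * tv_dist H1 H2"
proof -
  have sets: "sets H1 = sets (restrict_space borel (pos_sphere \<tau>))" "sets H2 = sets H1"
    using ang by (auto simp: angular_measure_def)
  have space: "space H1 = pos_sphere \<tau>"
    using sets_eq_imp_space_eq[OF sets(1)] by (simp add: space_restrict_space)
  have meas: "max_prod z \<in> borel_measurable H1"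
    unfolding measurable_cong_sets[OF sets(1) refl] by (intro measurable_restrict_space1) measurable
  have "\<bar>(\<integral>s. max_prod z s \<partial>H1) - (\<integral>s. max_prod z s \<partial>H2)\<bar>
      \<le> (infnorm z * M_inf (pos_sphere \<tau>)) * tv_dist H1 H2"
  proof (intro integral_diff_le_tv_dist finite_angular_measure[OF ang(1)]
      finite_angular_measure[OF ang(2)] sets(2) meas conjI)
    obtain s where "s \<in> pos_sphere \<tau>" using pos_sphere_nonempty by auto
    then have "0 \<le> M_inf (pos_sphere \<tau>)"
      using infnorm_le_M_inf infnorm_pos_le order_trans by blast
    then show "0 \<le> infnorm z * M_inf (pos_sphere \<tau>)" by (simp add: infnorm_pos_le)
  next
    fix s assume "s \<in> space H1"
    then have s: "s \<in> pos_sphere \<tau>" by (simp add: space)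
    then show "0 \<le> max_prod z s" using max_prod_nonneg[OF z(1)] by (simp add: pos_sphere_def)
    show "max_prod z s \<le> infnorm z * M_inf (pos_sphere \<tau>)"
      using max_prod_le_infnorm[of z s] mult_left_mono[OF infnorm_le_M_inf[OF s] infnorm_pos_le[of z]]
      by linarith
  qed
  moreover have "infnorm z > 0" using z by (simp add: infnorm_pos_lt)
  ultimately show ?thesis
    by (simp add: stdf_angular_measure[OF F(1) ang(1) z(1)] stdf_angular_measure[OF F(2) ang(2) z(1)]
        divide_le_eq mult_ac)
qed

end

section \<open>Archimax copulas\<close>

lemma generator_diff_le:
  fixes \<psi> :: "real \<Rightarrow> real"
  assumes diff: "\<And>t. t > 0 \<Longrightarrow> \<psi> differentiable (at t)"
    and K: "\<And>t. t > 0 \<Longrightarrow> t * \<bar>deriv \<psi> t\<bar> \<le> K"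
    and "0 < m" "m \<le> x" "m \<le> y"
  shows "\<bar>\<psi> x - \<psi> y\<bar> \<le> K * (\<bar>x - y\<bar> / m)"
  using assms(4,5)
proof (induction x y rule: linorder_less_wlog)
  case (less x y)
  obtain \<xi> where \<xi>: "x < \<xi>" "\<xi> < y" "\<psi> y - \<psi> x = (y - x) * deriv \<psi> \<xi>"
  proof -
    have "(\<psi> has_real_derivative deriv \<psi> t) (at t)" if "x \<le> t" "t \<le> y" for t
      using diff[of t] that less assms(3)
      by (simp add: DERIV_deriv_iff_real_differentiable)
    from MVT2[OF less(1) this] that show ?thesis by auto
  qed
  have "m * \<bar>deriv \<psi> \<xi>\<bar> \<le> \<xi> * \<bar>deriv \<psi> \<xi>\<bar>"
    using \<xi> less by (intro mult_right_mono) auto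
  also have "\<dots> \<le> K" using K[of \<xi>] \<xi> less assms(3) by simp
  finally have "\<bar>deriv \<psi> \<xi>\<bar> \<le> K / m" using assms(3) by (simp add: field_simps)
  then have "(y - x) * \<bar>deriv \<psi> \<xi>\<bar> \<le> (y - x) * (K / m)"
    using less by (intro mult_left_mono) auto
  moreover have "\<bar>\<psi> x - \<psi> y\<bar> = (y - x) * \<bar>deriv \<psi> \<xi>\<bar>"
    using \<xi>(3) less(1) abs_minus_commute[of "\<psi> x" "\<psi> y"] by (simp add: abs_mult)
  ultimately show ?case using less by (simp add: mult.commute)
next
  case (sym a b)
  then show ?case by (simp add: abs_minus_commute)
qed simp

context
  fixes \<psi> :: "real \<Rightarrow> real"
  assumes anti: "strict_antimono_on {0..} \<psi>" and pos: "\<And>t. t \<ge> 0 \<Longrightarrow> \<psi> t > 0"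
    and lim: "(\<psi> \<longlongrightarrow> 0) at_top"
begin

lemma generator_antimono: "0 \<le> s \<Longrightarrow> s \<le> t \<Longrightarrow> \<psi> t \<le> \<psi> s"
  using monotone_onD[OF anti, of s t] by (cases "s = t") auto

lemma generator_small:
  assumes "e > 0"
  obtains T where "T > 0" "\<psi> T < e"
proof -
  have "\<forall>\<^sub>F t in at_top. \<psi> t < e \<and> t > 0"
    using lim assms by (intro eventually_conj order_tendstoD eventually_gt_at_top)
  then have "\<exists>t. \<psi> t < e \<and> t > 0" by (intro eventually_happens'[OF trivial_limit_at_top_linorder])
  with that show ?thesis by blast
qed

lemma gen_inv_ge:
  assumes "u > 0" "T \<ge> 0" "\<And>t. 0 \<le> t \<Longrightarrow> \<psi> t \<le> u \<Longrightarrow> T \<le> t"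
  shows "T \<le> gen_inv \<psi> u"
proof -
  obtain t where "t > 0" "\<psi> t < u" using generator_small[OF assms(1)] .
  then have "{t. 0 \<le> t \<and> \<psi> t \<le> u} \<noteq> {}" by (auto intro!: exI[of _ t])
  then show ?thesis unfolding gen_inv_def using assms by (intro cInf_greatest) auto
qed

lemma gen_inv_orthant:
  assumes "u \<in> half_open_cube"
  shows "(\<chi> j. gen_inv \<psi> (u $ j)) \<in> orthant"
  using assms by (auto simp: orthant_def half_open_cube_def intro: gen_inv_ge)

text \<open>
  As \<open>u\<^sub>i\<close> tends to \<open>0\<close>, \<open>gen_inv \<psi> u\<^sub>i\<close> tends to infinity, hence so does \<open>l\<close>, and \<open>\<psi>\<close> tends to
  \<open>0\<close> there.  The value of \<open>Lim\<close> is determined because \<open>u\<close> is a limit point of the half-open cube.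
\<close>

lemma archimax_boundary:
  fixes l :: "real ^ 'd::finite \<Rightarrow> real"
  assumes l: "\<And>z. z \<in> orthant \<Longrightarrow> infnorm z \<le> l z"
    and u: "u \<in> unit_cube" "u \<notin> half_open_cube"
  shows "extend_by_continuity (archimax \<psi> l) u = 0"
proof -
  obtain i where i: "u $ i = 0" using u by (force simp: unit_cube_def half_open_cube_def less_le)
  have "u \<in> closure half_open_cube"
    unfolding closure_sequential
  proof (intro exI conjI allI)
    \<comment> \<open>Moving from \<open>u\<close> towards the corner \<open>(1, \<dots>, 1)\<close> makes all coordinates positive.\<close>
    define v where "v n = u + (1 / real (Suc n)) *\<^sub>R (1 - u)" for n
    have "v \<longlonglongrightarrow> u + 0 *\<^sub>R (1 - u)"
      unfolding v_def by (intro tendsto_intros LIMSEQ_Suc[OF lim_1_over_n])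
    then show "v \<longlonglongrightarrow> u" by simp
    fix n
    define e where "e = 1 / real (Suc n)"
    have e: "0 < e" "e \<le> 1" by (auto simp: e_def)
    have "0 < v n $ j \<and> v n $ j \<le> 1" for j
    proof -
      have uj: "0 \<le> u $ j" "u $ j \<le> 1" using u by (auto simp: unit_cube_def)
      have v: "v n $ j = (1 - e) * u $ j + e" by (simp add: v_def e_def algebra_simps del: of_nat_Suc)
      have "0 \<le> (1 - e) * u $ j" using e uj by simp
      moreover have "(1 - e) * u $ j \<le> 1 - e"
        using e uj mult_left_mono[of "u $ j" 1 "1 - e"] by simp
      ultimately show ?thesis
        using e unfolding v by (metis add_nonneg_pos le_diff_eq)
    qed
    then show "v n \<in> half_open_cube" by (simp add: half_open_cube_def)
  qed
  then have nontriv: "\<not> trivial_limit (at u within half_open_cube)"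
    using u by (simp add: closure_def trivial_limit_within)
  have "(archimax \<psi> l \<longlongrightarrow> 0) (at u within half_open_cube)"
  proof (rule tendstoI)
    fix e :: real assume "e > 0"
    then obtain T where T: "T > 0" "\<psi> T < e" using generator_small by blast
    have "((\<lambda>v. v $ i) \<longlongrightarrow> 0) (at u within half_open_cube)"
      using tendsto_vec_nth[OF tendsto_ident_at[of u half_open_cube], of i] i by simp
    then have "\<forall>\<^sub>F v in at u within half_open_cube. v $ i < \<psi> T"
      using pos[of T] T by (intro order_tendstoD) auto
    moreover have "\<forall>\<^sub>F v in at u within half_open_cube. v \<in> half_open_cube"
      by (simp add: eventually_at_filter)
    ultimately show "\<forall>\<^sub>F v in at u within half_open_cube. dist (archimax \<psi> l v) 0 < e"
    proof eventually_elim
      case (elim v)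
      define z where "z = (\<chi> j. gen_inv \<psi> (v $ j))"
      have z: "z \<in> orthant" unfolding z_def by (rule gen_inv_orthant[OF elim(2)])
      have "T \<le> z $ i"
        using elim T generator_antimono[of _ T]
        by (fastforce simp: z_def half_open_cube_def intro!: gen_inv_ge)
      also have "\<dots> \<le> l z"
        using component_le_infnorm_cart[of z i] l[OF z] by linarith
      finally have "T \<le> l z" .
      then have "\<psi> (l z) \<le> \<psi> T" "\<psi> (l z) > 0"
        using T by (auto intro: generator_antimono pos)
      then show ?case using T by (simp add: archimax_def z_def[symmetric] dist_norm)
    qed
  qed
  then show ?thesis
    using u nontriv by (simp add: extend_by_continuity_def tendsto_Lim)
qed

text \<open>
  The generator may jump at \<open>0\<close>, so that no Lipschitz estimate holds there; at \<open>z = 0\<close> the two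
  functions have to agree instead.
\<close>

lemma d_K_archimax_le:
  fixes l1 l2 :: "real ^ 'd::finite \<Rightarrow> real" and W :: ennreal
  assumes diff: "\<And>t. t > 0 \<Longrightarrow> \<psi> differentiable (at t)"
    and K: "bdd_above ((\<lambda>t. t * \<bar>deriv \<psi> t\<bar>) ` {0<..})"
    and l1: "\<And>z. z \<in> orthant \<Longrightarrow> infnorm z \<le> l1 z" and l2: "\<And>z. z \<in> orthant \<Longrightarrow> infnorm z \<le> l2 z"
    and l_0: "l1 0 = l2 0"
    and W: "\<And>z. z \<in> orthant \<Longrightarrow> z \<noteq> 0 \<Longrightarrow> ennreal (\<bar>l1 z - l2 z\<bar> / infnorm z) \<le> W"
  shows "ennreal (d_K (archimax \<psi> l1) (archimax \<psi> l2)) \<le> ennreal (K_gen \<psi>) * W"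
proof -
  have K_ge: "t * \<bar>deriv \<psi> t\<bar> \<le> K_gen \<psi>" if "t > 0" for t
    unfolding K_gen_def using that by (intro cSUP_upper[OF _ K]) auto
  have K_nonneg: "0 \<le> K_gen \<psi>" using K_ge[of 1] by simp
  have pointwise: "ennreal \<bar>extend_by_continuity (archimax \<psi> l1) u - extend_by_continuity (archimax \<psi> l2) u\<bar>
      \<le> ennreal (K_gen \<psi>) * W" if u: "u \<in> unit_cube" for u
  proof (cases "u \<in> half_open_cube")
    case False
    then show ?thesis using archimax_boundary[of l1 u] archimax_boundary[of l2 u] l1 l2 u by simp
  next
    case True
    define z where "z = (\<chi> j. gen_inv \<psi> (u $ j))"
    have z: "z \<in> orthant" unfolding z_def by (rule gen_inv_orthant[OF True])
    show ?thesis
    proof (cases "z = 0")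
      case True
      with \<open>u \<in> half_open_cube\<close> show ?thesis
        using l_0 by (simp add: extend_by_continuity_def archimax_def z_def[symmetric])
    next
      case False
      then have "infnorm z > 0" by (simp add: infnorm_pos_lt)
      then have "\<bar>\<psi> (l1 z) - \<psi> (l2 z)\<bar> \<le> K_gen \<psi> * (\<bar>l1 z - l2 z\<bar> / infnorm z)"
        using l1[OF z] l2[OF z] by (intro generator_diff_le diff K_ge)
      then have "ennreal \<bar>\<psi> (l1 z) - \<psi> (l2 z)\<bar> \<le> ennreal (K_gen \<psi>) * ennreal (\<bar>l1 z - l2 z\<bar> / infnorm z)"
        using K_nonneg by (simp add: ennreal_mult'[symmetric] ennreal_leI)
      also have "\<dots> \<le> ennreal (K_gen \<psi>) * W"
        using W[OF z False] by (intro mult_left_mono) auto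
      finally show ?thesis
        using \<open>u \<in> half_open_cube\<close>
        by (simp add: extend_by_continuity_def archimax_def z_def[symmetric])
    qed
  qed
  show ?thesis
  proof (cases "ennreal (K_gen \<psi>) * W")
    case (real c)
    have "0 \<in> (unit_cube :: (real ^ 'd) set)" by (simp add: unit_cube_def)
    then have "d_K (archimax \<psi> l1) (archimax \<psi> l2) \<le> c"
      unfolding d_K_def using pointwise real by (intro cSUP_least) (auto simp: ennreal_le_iff)
    then show ?thesis using real by (simp add: ennreal_leI)
  qed simp
qed

end

theorem mainTheorem7:
  fixes \<psi> :: "real \<Rightarrow> real"
    and F1 F2 :: "ereal ^ 'd::finite \<Rightarrow> real"
    and \<tau> :: "real ^ 'd \<Rightarrow> real"
    and H1 H2 :: "(real ^ 'd) measure"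
  assumes "CARD('d) \<ge> 2"
    and "\<psi> ` {0..} \<subseteq> {0<..1}"
    and "strict_generator CARD('d) \<psi>"
    and "\<forall>t > 0. \<psi> differentiable (at t)"
    and "continuous_on {0<..} (deriv \<psi>)"
    and "bdd_above ((\<lambda>t. t * \<bar>deriv \<psi> t\<bar>) ` {0<..})"
    and "max_stable F1" and "unit_frechet_margins F1"
    and "max_stable F2" and "unit_frechet_margins F2"
    and "is_norm \<tau> \<or> admissible_gauge \<tau>"
    and "angular_measure \<tau> F1 H1"
    and "angular_measure \<tau> F2 H2"
  shows "ennreal (d_K (archimax \<psi> (stdf F1)) (archimax \<psi> (stdf F2)))
     \<le> ennreal (K_gen \<psi>) *
         min (representer_W1 F1 F2) (ennreal (M_inf (pos_sphere \<tau>) * tv_dist H1 H2))"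
proof -
  have gauge: "admissible_gauge \<tau>"
    using assms(11) admissible_gauge_of_norm by blast
  have F: "distribution_fn F1" "distribution_fn F2"
    using assms(7,9) by (auto simp: max_stable_def)
  obtain M1 M2 :: "(real ^ 'd) measure" and Z1 Z2
    where rep: "de_haan_representer F1 M1 Z1" "de_haan_representer F2 M2 Z2"
    using assms(12,13) by (auto simp: angular_measure_def)
  have l1: "stdf F1 z = (\<integral>\<omega>. max_prod z (Z1 \<omega>) \<partial>M1)"
    and l2: "stdf F2 z = (\<integral>\<omega>. max_prod z (Z2 \<omega>) \<partial>M2)" if "z \<in> orthant" for z
    using stdf_representer[OF rep(1) F(1) that] stdf_representer[OF rep(2) F(2) that] by auto
  have zero: "(0 :: real ^ 'd) \<in> orthant" by (simp add: orthant_def)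
  show ?thesis
  proof (rule d_K_archimax_le)
    show "strict_antimono_on {0..} \<psi>" "(\<psi> \<longlongrightarrow> 0) at_top"
      using assms(3) by (auto simp: strict_generator_def)
    show "\<psi> t > 0" if "t \<ge> 0" for t
      using assms(2) that by (auto simp: image_subset_iff)
    show "\<psi> differentiable (at t)" if "t > 0" for t
      using assms(4) that by simp
    show "bdd_above ((\<lambda>t. t * \<bar>deriv \<psi> t\<bar>) ` {0<..})" by (rule assms(6))
    show "infnorm z \<le> stdf F1 z" "infnorm z \<le> stdf F2 z" if "z \<in> orthant" for z
      using infnorm_le_integral_max_prod[OF rep(1) that] infnorm_le_integral_max_prod[OF rep(2) that]
      by (simp_all add: l1 l2 that)
    show "stdf F1 0 = stdf F2 0" by (simp add: l1 l2 zero)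
    show "ennreal (\<bar>stdf F1 z - stdf F2 z\<bar> / infnorm z)
        \<le> min (representer_W1 F1 F2) (ennreal (M_inf (pos_sphere \<tau>) * tv_dist H1 H2))"
      if "z \<in> orthant" "z \<noteq> 0" for z
      using stdf_diff_le_W1[OF F that]
        stdf_diff_le_tv_dist[OF gauge F assms(12,13) that] by (simp add: ennreal_leI)
  qed
qed

end
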